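(* Let $a<b$ be real numbers and let $f,g:[a,b]\to\mathbb{R}$ be continuous functions with $f(x)\ge 0$ and $g(x)\ge 0$ for all $x\in[a,b]$. Then $$\left(\int_a^b f(x)g(x)\,dx\right)^2\le \int_a^b [\max(f(x),g(x))]^2\,dx\cdot\int_a^b[\min(f(x),g(x))]^2\,dx\le \int_a^b f^2(x)\,dx\cdot\int_a^b g^2(x)\,dx .$$
   Context: Integrals are Riemann integrals over a finite interval; $\max(f(x),g(x))$ and $\min(f(x),g(x))$ are taken pointwise. *)

theory Defs
  imports "HOL-Analysis.Analysis"
begin

end

theory Submission
  imports Defs
begin

text \<open>
  Write \<open>M\<close> and \<open>m\<close> for the pointwise maximum and minimum of \<open>f\<close> and \<open>g\<close>. At each point
  \<open>{M, m} = {f, g}\<close>, hence \<open>f g = M m\<close> and \<open>M\<^sup>2 + m\<^sup>2 = f\<^sup>2 + g\<^sup>2\<close>. The first identity turns the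
  left inequality into the Cauchy--Schwarz inequality for \<open>M\<close> and \<open>m\<close>. By the second, the
  integrals \<open>A\<close>, \<open>B\<close>, \<open>F\<close>, \<open>G\<close> of \<open>M\<^sup>2\<close>, \<open>m\<^sup>2\<close>, \<open>f\<^sup>2\<close>, \<open>g\<^sup>2\<close> satisfy \<open>A + B = F + G\<close>, and
  \<open>B \<le> F \<le> A\<close> because \<open>f\<close> and \<open>g\<close> are nonnegative. Of two pairs with equal sums, the more spread
  out one has the smaller product: \<open>F G - A B = (A - F) (F - B) \<ge> 0\<close>.
\<close>

lemma Cauchy_Schwarz_integral:
  fixes u v :: "'a::euclidean_space \<Rightarrow> real"
  assumes u: "(\<lambda>x. (u x)\<^sup>2) integrable_on S"
    and v: "(\<lambda>x. (v x)\<^sup>2) integrable_on S"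
    and uv: "(\<lambda>x. u x * v x) integrable_on S"
  shows "(integral S (\<lambda>x. u x * v x))\<^sup>2
    \<le> integral S (\<lambda>x. (u x)\<^sup>2) * integral S (\<lambda>x. (v x)\<^sup>2)"
proof -
  define P where "P = integral S (\<lambda>x. (u x)\<^sup>2)"
  define Q where "Q = integral S (\<lambda>x. (v x)\<^sup>2)"
  define C where "C = integral S (\<lambda>x. u x * v x)"
  have quad: "0 \<le> s\<^sup>2 * P + 2 * s * t * C + t\<^sup>2 * Q" for s t
  proof -
    have "((\<lambda>x. s\<^sup>2 * (u x)\<^sup>2 + 2 * s * t * (u x * v x) + t\<^sup>2 * (v x)\<^sup>2)
        has_integral s\<^sup>2 * P + 2 * s * t * C + t\<^sup>2 * Q) S"
      unfolding P_def Q_def C_def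
      by (intro has_integral_add has_integral_mult_right integrable_integral u v uv)
    moreover have "0 \<le> s\<^sup>2 * (u x)\<^sup>2 + 2 * s * t * (u x * v x) + t\<^sup>2 * (v x)\<^sup>2" for x
      using zero_le_power2[of "s * u x + t * v x"]
      by (simp add: power2_eq_square algebra_simps)
    ultimately show ?thesis
      by (rule has_integral_nonneg)
  qed
  have "0 \<le> Q"
    using quad[of 0 1] by simp
  have "C\<^sup>2 \<le> P * Q"
  proof (cases "Q = 0")
    case True
    have "C = 0"
    proof (rule ccontr)
      assume "C \<noteq> 0"
      \<comment> \<open>The form is now affine in \<open>t\<close> with slope \<open>2 C\<close>; this \<open>t\<close> gives it the value \<open>-1\<close>.\<close>
      with quad[of 1 "- (P + 1) / (2 * C)"] True show False
        by (simp add: field_simps)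
    qed
    with True show ?thesis by simp
  next
    case False
    \<comment> \<open>The minimiser of the form on the line \<open>s = Q\<close> is \<open>t = -C\<close>.\<close>
    have "0 \<le> Q * (P * Q - C\<^sup>2)"
      using quad[of Q "- C"] by (simp add: power2_eq_square algebra_simps)
    with False \<open>0 \<le> Q\<close> show ?thesis
      by (simp add: zero_le_mult_iff)
  qed
  then show ?thesis
    unfolding P_def Q_def C_def .
qed

theorem theorem10:
  fixes a b :: real and f g :: "real \<Rightarrow> real"
  assumes "a < b"
    and "continuous_on {a..b} f"
    and "continuous_on {a..b} g"
    and "\<forall>x\<in>{a..b}. f x \<ge> 0"
    and "\<forall>x\<in>{a..b}. g x \<ge> 0"
  shows "(integral {a..b} (\<lambda>x. f x * g x))\<^sup>2
           \<le> integral {a..b} (\<lambda>x. (max (f x) (g x))\<^sup>2) * integral {a..b} (\<lambda>x. (min (f x) (g x))\<^sup>2)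
       \<and> integral {a..b} (\<lambda>x. (max (f x) (g x))\<^sup>2) * integral {a..b} (\<lambda>x. (min (f x) (g x))\<^sup>2)
           \<le> integral {a..b} (\<lambda>x. (f x)\<^sup>2) * integral {a..b} (\<lambda>x. (g x)\<^sup>2)"
proof -
  let ?I = "\<lambda>h. integral {a..b} h"
  let ?M = "\<lambda>x. max (f x) (g x)" and ?m = "\<lambda>x. min (f x) (g x)"
  have f: "(\<lambda>x. (f x)\<^sup>2) integrable_on {a..b}" and g: "(\<lambda>x. (g x)\<^sup>2) integrable_on {a..b}"
    and M: "(\<lambda>x. (?M x)\<^sup>2) integrable_on {a..b}" and m: "(\<lambda>x. (?m x)\<^sup>2) integrable_on {a..b}"
    and Mm: "(\<lambda>x. ?M x * ?m x) integrable_on {a..b}"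
    by (intro integrable_continuous_real continuous_intros assms)+
  have "f x * g x = ?M x * ?m x" for x
    by (simp add: max_def min_def)
  then have left: "(?I (\<lambda>x. f x * g x))\<^sup>2 \<le> ?I (\<lambda>x. (?M x)\<^sup>2) * ?I (\<lambda>x. (?m x)\<^sup>2)"
    using Cauchy_Schwarz_integral[OF M m Mm] by simp
  have "(?M x)\<^sup>2 + (?m x)\<^sup>2 = (f x)\<^sup>2 + (g x)\<^sup>2" for x
    by (simp add: max_def min_def)
  then have sum: "?I (\<lambda>x. (?M x)\<^sup>2) + ?I (\<lambda>x. (?m x)\<^sup>2) = ?I (\<lambda>x. (f x)\<^sup>2) + ?I (\<lambda>x. (g x)\<^sup>2)"
    by (simp add: integral_add[OF M m, symmetric] integral_add[OF f g, symmetric])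
  have "?I (\<lambda>x. (?m x)\<^sup>2) \<le> ?I (\<lambda>x. (f x)\<^sup>2)"
    using assms(4,5) by (intro integral_le m f power_mono) auto
  moreover have "?I (\<lambda>x. (f x)\<^sup>2) \<le> ?I (\<lambda>x. (?M x)\<^sup>2)"
    using assms(4,5) by (intro integral_le M f power_mono) auto
  ultimately have "0 \<le> (?I (\<lambda>x. (?M x)\<^sup>2) - ?I (\<lambda>x. (f x)\<^sup>2)) * (?I (\<lambda>x. (f x)\<^sup>2) - ?I (\<lambda>x. (?m x)\<^sup>2))"
    by simp
  also have "\<dots> = ?I (\<lambda>x. (f x)\<^sup>2) * (?I (\<lambda>x. (?M x)\<^sup>2) + ?I (\<lambda>x. (?m x)\<^sup>2) - ?I (\<lambda>x. (f x)\<^sup>2))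
      - ?I (\<lambda>x. (?M x)\<^sup>2) * ?I (\<lambda>x. (?m x)\<^sup>2)"
    by (simp add: algebra_simps)
  also have "\<dots> = ?I (\<lambda>x. (f x)\<^sup>2) * ?I (\<lambda>x. (g x)\<^sup>2) - ?I (\<lambda>x. (?M x)\<^sup>2) * ?I (\<lambda>x. (?m x)\<^sup>2)"
    by (simp add: sum)
  finally show ?thesis
    using left by simp
qed

end
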